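(* Let $p>2$, and let $J_p\subseteq[0,\frac1{p-1}]$ be the set of real numbers having an expansion in base $p$ with digits $0,1$ (each $x\in J_p$ then has a unique expansion). (i) $J_p$ is a Cantor set of Hausdorff dimension $\frac{1}{\log_2 p}$, and hence a null set (for Lebesgue measure). (ii) $x\in J_p$ is a right accumulation point of $J_p$ if and only if its unique expansion has infinitely many zero digits. (iii) $x\in J_p$ is a left accumulation point of $J_p$ if and only if its unique expansion has infinitely many one digits.
   Context: For $p>1$ an expansion of $x$ in base $p$ is a sequence $(c_i)_{i\ge1}\in\{0,1\}^\infty$ with $\sum_{i=1}^\infty c_ip^{-i}=x$; $J_p$ is the set of all $x$ having at least one expansion. A Cantor set is a non-empty compact set of real numbers having neither interior points nor isolated points. A point $x$ is a right (resp. left) accumulation point of $J_p$ if there is a sequence in $J_p$ converging to $x$ all of whose terms are $>x$ (resp. $<x$). *)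

theory Defs
  imports "HOL-Analysis.Analysis"
begin

text \<open>Digit sequences are indexed from 0: the digit written \<open>c\<^sub>i\<close> (\<open>i \<ge> 1\<close>) in the
  mathematical text is \<open>c (i - 1)\<close> here.\<close>

definition is_expansion :: "real \<Rightarrow> (nat \<Rightarrow> nat) \<Rightarrow> real \<Rightarrow> bool" where
  "is_expansion p c x \<longleftrightarrow> range c \<subseteq> {0, 1} \<and> (\<lambda>i. real (c i) / p ^ Suc i) sums x"

definition J :: "real \<Rightarrow> real set" where
  "J p = {x. \<exists>c. is_expansion p c x}"

definition cantor_set :: "real set \<Rightarrow> bool" where
  "cantor_set S \<longleftrightarrow> S \<noteq> {} \<and> compact S \<and> interior S = {} \<and> (\<forall>x. \<not> x isolated_in S)"

definition right_accumulation_point :: "real \<Rightarrow> real set \<Rightarrow> bool" where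
  "right_accumulation_point x S \<longleftrightarrow>
     (\<exists>y :: nat \<Rightarrow> real. (\<forall>n. y n \<in> S \<and> x < y n) \<and> y \<longlonglongrightarrow> x)"

definition left_accumulation_point :: "real \<Rightarrow> real set \<Rightarrow> bool" where
  "left_accumulation_point x S \<longleftrightarrow>
     (\<exists>y :: nat \<Rightarrow> real. (\<forall>n. y n \<in> S \<and> y n < x) \<and> y \<longlonglongrightarrow> x)"

text \<open>The \<open>s\<close>-th power of the diameter of a bounded set, with the usual conventions that the
  empty set contributes 0 and that \<open>0\<close> to the power \<open>0\<close> is \<open>1\<close> (whereas \<open>0 powr 0 = 0\<close>).\<close>

definition diameter_pow :: "real \<Rightarrow> 'a::metric_space set \<Rightarrow> ennreal" where
  "diameter_pow s U =
     (if U = {} then 0 else if s = 0 then 1 else ennreal (diameter U powr s))"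

text \<open>Boundedness of the covering sets is required explicitly because \<^const>\<open>diameter\<close> is only
  meaningful for bounded sets. Finite covers are included, as covering sets may be empty.\<close>

definition hausdorff_premeasure :: "real \<Rightarrow> real \<Rightarrow> 'a::metric_space set \<Rightarrow> ennreal" where
  "hausdorff_premeasure s \<delta> S =
     Inf {(\<Sum>i. diameter_pow s (U i)) | U :: nat \<Rightarrow> 'a set.
            S \<subseteq> (\<Union>i. U i) \<and> (\<forall>i. bounded (U i) \<and> diameter (U i) \<le> \<delta>)}"

definition hausdorff_measure :: "real \<Rightarrow> 'a::metric_space set \<Rightarrow> ennreal" where
  "hausdorff_measure s S = (SUP \<delta>\<in>{0<..}. hausdorff_premeasure s \<delta> S)"

definition hausdorff_dimension :: "'a::metric_space set \<Rightarrow> ennreal" where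
  "hausdorff_dimension S = Inf {ennreal s | s. 0 \<le> s \<and> hausdorff_measure s S = 0}"

end

theory Submission
  imports Defs
begin

text \<open>If two digit sequences first differ at position \<open>n\<close> (counting from 0), their values in
  base \<open>p > 2\<close> are in the order of the digits and at least \<open>(p - 2) / ((p - 1) * p ^ Suc n)\<close>
  apart; if they agree below \<open>n\<close>, they are at most \<open>1 / ((p - 1) * p ^ n)\<close> apart. This gives
  uniqueness, the description of the accumulation points, and a cover of \<open>J p\<close> by \<open>2 ^ n\<close>
  cylinders which bounds the dimension from above. Compactness comes from the product topology on
  digit sequences. The inclusion of \<open>J p\<close> in \<open>J p / p \<union> (J p + 1) / p\<close> shows that the measure of
  \<open>J p\<close> is at most \<open>2 / p\<close> times itself, hence zero. For the lower bound on the dimension, reading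
  the digits in base 2 defines a map of \<open>J p\<close> onto a set containing \<open>{0..<1}\<close> which is Hoelder
  of exponent \<open>s = 1 / log 2 p\<close>; so every cover \<open>U\<close> of \<open>J p\<close> induces a cover of \<open>{0..<1}\<close> by intervals of
  length at most a constant times \<open>diameter (U i) powr s\<close>.\<close>

subsection \<open>Values of digit sequences\<close>

definition digit_seqs :: "(nat \<Rightarrow> nat) set" where
  "digit_seqs = {c. \<forall>i. c i \<le> 1}"

text \<open>The base is a parameter because the same digits are later read both in base
  \<open>p\<close> and in base 2.\<close>

definition expansion_value :: "real \<Rightarrow> (nat \<Rightarrow> nat) \<Rightarrow> real" where
  "expansion_value b c = (\<Sum>i. real (c i) / b ^ Suc i)"

lemma digit_seqs_iff: "c \<in> digit_seqs \<longleftrightarrow> range c \<subseteq> {0, 1}"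
  unfolding digit_seqs_def by (simp add: image_subset_iff le_Suc_eq)

lemma digit_le_1: "c \<in> digit_seqs \<Longrightarrow> c i \<le> 1"
  by (simp add: digit_seqs_def)

lemma digit_cases:
  assumes "c \<in> digit_seqs"
  obtains "c i = 0" | "c i = 1"
  using digit_le_1[OF assms, of i] by linarith

lemma digit_seqs_fun_upd: "c \<in> digit_seqs \<Longrightarrow> a \<in> {0, 1} \<Longrightarrow> c(n := a) \<in> digit_seqs"
  unfolding digit_seqs_def by auto

lemma digit_seqs_shift: "c \<in> digit_seqs \<Longrightarrow> (\<lambda>i. c (i + n)) \<in> digit_seqs"
  unfolding digit_seqs_def by auto

lemma sums_geometric_expansion:
  fixes b :: real
  assumes "b > 1"
  shows "(\<lambda>i. 1 / b ^ Suc i) sums (1 / (b - 1))"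
proof -
  have "(\<lambda>i. (1/b) * (1/b) ^ i) sums ((1/b) * (1 / (1 - 1/b)))"
    using assms by (intro sums_mult geometric_sums) auto
  moreover have "(1/b) * (1 / (1 - 1/b)) = 1 / (b - 1)"
    using assms by (simp add: field_simps)
  ultimately show ?thesis by (simp add: power_divide)
qed

lemma summable_expansion:
  fixes b :: real
  assumes "b > 1" "c \<in> digit_seqs"
  shows "summable (\<lambda>i. real (c i) / b ^ Suc i)"
proof (rule summable_comparison_test')
  show "summable (\<lambda>i. 1 / b ^ Suc i)"
    using sums_geometric_expansion[OF assms(1)] by (rule sums_summable)
  show "norm (real (c i) / b ^ Suc i) \<le> 1 / b ^ Suc i" for i
    using assms digit_le_1[OF assms(2), of i] by (simp add: divide_right_mono)
qed

lemma expansion_value_nonneg: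
  assumes "b > 1" "c \<in> digit_seqs"
  shows "0 \<le> expansion_value b c"
  unfolding expansion_value_def
  using assms by (intro suminf_nonneg summable_expansion) auto

lemma expansion_value_le:
  assumes "b > 1" "c \<in> digit_seqs"
  shows "expansion_value b c \<le> 1 / (b - 1)"
proof -
  have "expansion_value b c \<le> (\<Sum>i. 1 / b ^ Suc i)"
    unfolding expansion_value_def
  proof (rule suminf_le)
    show "real (c i) / b ^ Suc i \<le> 1 / b ^ Suc i" for i
      using assms digit_le_1[OF assms(2), of i] by (simp add: divide_right_mono)
    show "summable (\<lambda>i. 1 / b ^ Suc i)"
      using sums_geometric_expansion[OF assms(1)] by (rule sums_summable)
  qed (use assms in \<open>rule summable_expansion\<close>)
  then show ?thesis
    using sums_unique[OF sums_geometric_expansion[OF assms(1)]] by simp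
qed

lemma is_expansion_iff:
  assumes "p > 1"
  shows "is_expansion p c x \<longleftrightarrow> c \<in> digit_seqs \<and> expansion_value p c = x"
  using summable_expansion[OF assms, of c]
  unfolding is_expansion_def expansion_value_def digit_seqs_iff[symmetric]
  by (auto simp: sums_iff)

lemma J_eq_image: "p > 1 \<Longrightarrow> J p = expansion_value p ` digit_seqs"
  unfolding J_def by (auto simp: is_expansion_iff)

lemma expansion_value_split:
  assumes "b > 1" "c \<in> digit_seqs"
  shows "expansion_value b c
    = (\<Sum>i<n. real (c i) / b ^ Suc i) + expansion_value b (\<lambda>i. c (i + n)) / b ^ n"
proof -
  have "(\<Sum>i. real (c (i + n)) / b ^ Suc (i + n)) = expansion_value b (\<lambda>i. c (i + n)) / b ^ n"
    unfolding expansion_value_def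
    by (subst suminf_divide[symmetric])
       (use summable_expansion[OF assms(1) digit_seqs_shift[OF assms(2)]] in
        \<open>auto simp: power_add mult_ac\<close>)
  then show ?thesis
    unfolding expansion_value_def
    by (subst suminf_split_initial_segment[OF summable_expansion[OF assms], of n]) simp
qed

text \<open>Splitting after position \<open>n\<close> leaves the earlier digits and the tail
  unchanged. This produces points of \<open>J p\<close> at a known distance from a given
  one.\<close>

lemma expansion_value_fun_upd:
  assumes "b > 1" "c \<in> digit_seqs" "a \<in> {0, 1}"
  shows "expansion_value b (c(n := a)) = expansion_value b c + (real a - real (c n)) / b ^ Suc n"
proof -
  have *: "expansion_value b d = (\<Sum>i<n. real (d i) / b ^ Suc i) + real (d n) / b ^ Suc n
      + expansion_value b (\<lambda>i. d (i + Suc n)) / b ^ Suc n" if "d \<in> digit_seqs" for d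
    using expansion_value_split[OF assms(1) that, of "Suc n"] by simp
  show ?thesis
    unfolding *[OF assms(2)] *[OF digit_seqs_fun_upd[OF assms(2,3)]]
    by (simp add: diff_divide_distrib)
qed

text \<open>The common initial segment cancels; both tails lie between 0 and
  \<open>1 / (b - 1)\<close> before scaling by \<open>1 / b ^ n\<close>.\<close>

lemma expansion_value_dist_le:
  assumes "b > 1" "c \<in> digit_seqs" "d \<in> digit_seqs" "\<And>k. k < n \<Longrightarrow> c k = d k"
  shows "\<bar>expansion_value b c - expansion_value b d\<bar> \<le> 1 / ((b - 1) * b ^ n)"
proof -
  let ?c = "\<lambda>i. c (i + n)" and ?d = "\<lambda>i. d (i + n)"
  have "expansion_value b c - expansion_value b d
      = (expansion_value b ?c - expansion_value b ?d) / b ^ n"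
    unfolding expansion_value_split[OF assms(1,2), of n] expansion_value_split[OF assms(1,3), of n]
    using assms(4) by (simp add: diff_divide_distrib)
  moreover have "\<bar>expansion_value b ?c - expansion_value b ?d\<bar> \<le> 1 / (b - 1)"
    using expansion_value_nonneg[OF assms(1) digit_seqs_shift[OF assms(2)], of n]
      expansion_value_nonneg[OF assms(1) digit_seqs_shift[OF assms(3)], of n]
      expansion_value_le[OF assms(1) digit_seqs_shift[OF assms(2)], of n]
      expansion_value_le[OF assms(1) digit_seqs_shift[OF assms(3)], of n]
    by linarith
  ultimately show ?thesis
    using assms(1) by (simp add: abs_divide divide_right_mono flip: divide_divide_eq_left)
qed

text \<open>The digit 1 against 0 gains \<open>1 / b ^ Suc n\<close>, and the tails can win back at
  most \<open>1 / (b - 1)\<close> of that. What remains is positive exactly when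
  \<open>b > 2\<close>; for \<open>b = 2\<close> the bound degenerates to 0.\<close>

lemma expansion_value_gap:
  assumes "b > 1" "c \<in> digit_seqs" "d \<in> digit_seqs" "\<And>k. k < n \<Longrightarrow> c k = d k" "c n < d n"
  shows "expansion_value b d - expansion_value b c \<ge> (b - 2) / ((b - 1) * b ^ Suc n)"
proof -
  let ?c = "\<lambda>i. c (i + Suc n)" and ?d = "\<lambda>i. d (i + Suc n)"
  have "c n = 0" "d n = 1"
    using assms(5) digit_le_1[OF assms(3), of n] by auto
  then have "expansion_value b d - expansion_value b c
      = (1 + expansion_value b ?d - expansion_value b ?c) / b ^ Suc n"
    unfolding expansion_value_split[OF assms(1,2), of "Suc n"]
      expansion_value_split[OF assms(1,3), of "Suc n"]
    using assms(4) by (simp add: diff_divide_distrib add_divide_distrib)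
  moreover have "(b - 2) / (b - 1) = 1 - 1 / (b - 1)"
    using assms(1) by (simp add: field_simps)
  then have "1 + expansion_value b ?d - expansion_value b ?c \<ge> (b - 2) / (b - 1)"
    using expansion_value_nonneg[OF assms(1) digit_seqs_shift[OF assms(3)], of "Suc n"]
      expansion_value_le[OF assms(1) digit_seqs_shift[OF assms(2)], of "Suc n"]
    by linarith
  ultimately show ?thesis
    using assms(1) by (simp add: divide_right_mono del: power_Suc flip: divide_divide_eq_left)
qed

lemma first_difference:
  fixes c d :: "nat \<Rightarrow> 'a"
  assumes "c \<noteq> d"
  obtains n where "\<And>k. k < n \<Longrightarrow> c k = d k" "c n \<noteq> d n"
proof -
  from assms obtain m where "c m \<noteq> d m" by auto
  then have "c (LEAST n. c n \<noteq> d n) \<noteq> d (LEAST n. c n \<noteq> d n)" by (rule LeastI)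
  with not_less_Least[of _ "\<lambda>n. c n \<noteq> d n"] show ?thesis by (blast intro: that)
qed

lemma expansion_value_gap_abs:
  assumes "b > 1" "c \<in> digit_seqs" "d \<in> digit_seqs" "\<And>k. k < n \<Longrightarrow> c k = d k" "c n \<noteq> d n"
  shows "\<bar>expansion_value b d - expansion_value b c\<bar> \<ge> (b - 2) / ((b - 1) * b ^ Suc n)"
  using expansion_value_gap[of b c d n] expansion_value_gap[of b d c n] assms
  by (cases "c n < d n") (force simp: not_less)+

lemma inj_on_expansion_value:
  assumes "b > 2"
  shows "inj_on (expansion_value b) digit_seqs"
proof (rule inj_onI, rule ccontr)
  fix c d assume cd: "c \<in> digit_seqs" "d \<in> digit_seqs" "expansion_value b c = expansion_value b d"
    and "c \<noteq> d"
  then obtain n where "\<And>k. k < n \<Longrightarrow> c k = d k" "c n \<noteq> d n" by (metis first_difference)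
  with expansion_value_gap_abs[of b c d n] cd assms
  have "(b - 2) / ((b - 1) * b ^ Suc n) \<le> 0" by simp
  moreover have "(b - 2) / ((b - 1) * b ^ Suc n) > 0" using assms by simp
  ultimately show False by linarith
qed

subsection \<open>Topology and Lebesgue measure of \<open>J p\<close>\<close>

text \<open>Tychonoff: a product of finite sets is compact, and the topology of the function type is
  the product topology.\<close>

lemma compact_digit_seqs: "compact digit_seqs"
proof -
  have "compactin (product_topology (\<lambda>_. euclidean) UNIV) (PiE UNIV (\<lambda>_::nat. {0, 1::nat}))"
    by (subst compactin_PiE) (auto intro: finite_imp_compact)
  moreover have "PiE UNIV (\<lambda>_::nat. {0, 1::nat}) = digit_seqs"
    by (simp add: digit_seqs_def PiE_def Pi_def le_Suc_eq)
  ultimately show ?thesis by (simp add: euclidean_product_topology)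
qed

text \<open>Each partial sum depends on finitely many coordinates, and the M-test makes the
  convergence uniform.\<close>

lemma continuous_on_expansion_value:
  assumes "b > 1"
  shows "continuous_on digit_seqs (expansion_value b)"
proof -
  have "uniform_limit digit_seqs (\<lambda>n c. \<Sum>i<n. real (c i) / b ^ Suc i)
      (\<lambda>c. \<Sum>i. real (c i) / b ^ Suc i) sequentially"
  proof (rule Weierstrass_m_test)
    show "summable (\<lambda>i. 1 / b ^ Suc i)"
      using sums_geometric_expansion[OF assms(1)] by (rule sums_summable)
    show "norm (real (c i) / b ^ Suc i) \<le> 1 / b ^ Suc i" if "c \<in> digit_seqs" for c i
      using assms digit_le_1[OF that, of i] by (simp add: divide_right_mono)
  qed
  moreover have "continuous_on digit_seqs (\<lambda>c. \<Sum>i<n. real (c i) / b ^ Suc i)" for n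
    using assms
    by (intro continuous_intros continuous_on_of_nat
        continuous_on_subset[OF continuous_on_product_coordinates]) auto
  ultimately show ?thesis
    unfolding expansion_value_def
    by (intro uniform_limit_theorem[where F = sequentially]) auto
qed

lemma compact_J: "p > 1 \<Longrightarrow> compact (J p)"
  by (simp add: J_eq_image compact_continuous_image continuous_on_expansion_value compact_digit_seqs)

lemma J_subset: "p > 1 \<Longrightarrow> J p \<subseteq> {0..1 / (p - 1)}"
  by (auto simp: J_eq_image expansion_value_nonneg expansion_value_le)

text \<open>The two pieces correspond to the first digit 0 or 1; the remaining digits give the point
  of \<open>J p\<close> to be scaled.\<close>

lemma J_self_similar:
  assumes "p > 1"
  shows "J p \<subseteq> (\<lambda>x. x / p) ` J p \<union> (\<lambda>x. x / p + 1 / p) ` J p"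
proof
  fix x assume "x \<in> J p"
  then obtain c where c: "c \<in> digit_seqs" and x: "x = expansion_value p c"
    using assms by (auto simp: J_eq_image)
  have "expansion_value p (\<lambda>i. c (i + 1)) \<in> J p"
    using assms c by (auto simp: J_eq_image digit_seqs_shift simp del: One_nat_def)
  moreover have "x = real (c 0) / p + expansion_value p (\<lambda>i. c (i + 1)) / p"
    using expansion_value_split[OF assms c, of 1] by (simp add: x)
  ultimately show "x \<in> (\<lambda>x. x / p) ` J p \<union> (\<lambda>x. x / p + 1 / p) ` J p"
    by (cases rule: digit_cases[OF c, of 0]) auto
qed

lemma null_sets_J:
  assumes "p > 2"
  shows "J p \<in> null_sets lebesgue"
proof -
  have J: "J p \<in> lmeasurable"
    using assms by (intro lmeasurable_compact compact_J) auto
  \<comment> \<open>Both pieces have this form, with \<open>e = 0\<close> and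
    \<open>e = 1 / p\<close>.\<close>
  have scale: "(\<lambda>x. x / p + e) ` J p \<in> lmeasurable
      \<and> measure lebesgue ((\<lambda>x. x / p + e) ` J p) = measure lebesgue (J p) / p" for e
  proof
    have "compact ((\<lambda>x. x / p + e) ` J p)"
      using assms by (intro compact_continuous_image continuous_intros compact_J) auto
    then show "(\<lambda>x. x / p + e) ` J p \<in> lmeasurable" by (rule lmeasurable_compact)
    show "measure lebesgue ((\<lambda>x. x / p + e) ` J p) = measure lebesgue (J p) / p"
      using measure_lebesgue_affine[of "1/p" e "J p"] assms by simp
  qed
  have "measure lebesgue (J p)
      \<le> measure lebesgue ((\<lambda>x. x / p) ` J p \<union> (\<lambda>x. x / p + 1 / p) ` J p)"
    using scale[of 0] scale[of "1/p"] J J_self_similar[of p] assms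
    by (intro measure_mono_fmeasurable) auto
  also have "\<dots> \<le> measure lebesgue ((\<lambda>x. x / p) ` J p)
      + measure lebesgue ((\<lambda>x. x / p + 1 / p) ` J p)"
    using scale[of 0] scale[of "1/p"] by (intro measure_Un_le) auto
  also have "\<dots> = 2 * measure lebesgue (J p) / p"
    using scale[of 0] scale[of "1/p"] by simp
  \<comment> \<open>Since the measure of the compact set is finite and \<open>p > 2\<close>, this
    inequality leaves only the value 0.\<close>
  finally have "p * measure lebesgue (J p) \<le> 2 * measure lebesgue (J p)"
    using assms by (simp add: field_simps)
  moreover have "measure lebesgue (J p) \<ge> 0" by simp
  ultimately have "measure lebesgue (J p) = 0"
    using assms by (metis antisym_conv mult_le_cancel_right not_le)
  with J show ?thesis
    by (auto simp: null_sets_def emeasure_eq_measure2 fmeasurableD)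
qed

section \<open>One-sided accumulation points and the Cantor property\<close>

lemma tendsto_inverse_power_Suc:
  fixes b :: real
  assumes "b > 1"
  shows "(\<lambda>n. 1 / b ^ Suc n) \<longlonglongrightarrow> 0"
  using sums_summable[OF sums_geometric_expansion[OF assms]] by (rule summable_LIMSEQ_zero)

text \<open>Changing a zero digit at position \<open>n\<close> to one increases the value by \<open>1 / p ^ Suc n\<close>.
  Conversely, a larger element of \<open>J p\<close> first differs from \<open>c\<close> at a zero of \<open>c\<close>; if these
  positions are bounded,
  the gap estimate keeps such elements away from the value of \<open>c\<close>.\<close>

lemma right_accumulation_point_iff:
  assumes p: "p > 2" and c: "c \<in> digit_seqs"
  shows "right_accumulation_point (expansion_value p c) (J p) \<longleftrightarrow> infinite {i. c i = 0}"
proof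
  assume inf: "infinite {i. c i = 0}"
  define e where "e = enumerate {i. c i = 0}"
  have e: "c (e n) = 0" for n
    using enumerate_in_set[OF inf] by (auto simp: e_def)
  have "(\<lambda>n. expansion_value p c + 1 / p ^ Suc (e n)) \<longlonglongrightarrow> expansion_value p c + 0"
    using p filterlim_compose[OF tendsto_inverse_power_Suc
        filterlim_subseq[OF strict_mono_enumerate[OF inf]], of p]
    by (intro tendsto_intros) (auto simp: e_def)
  moreover have "expansion_value p c + 1 / p ^ Suc (e n) \<in> J p" for n
    using p expansion_value_fun_upd[of p c 1 "e n"] c e digit_seqs_fun_upd[OF c, of 1 "e n"]
    by (force simp: J_eq_image)
  ultimately show "right_accumulation_point (expansion_value p c) (J p)"
    unfolding right_accumulation_point_def
    using p by (intro exI[of _ "\<lambda>n. expansion_value p c + 1 / p ^ Suc (e n)"]) auto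
next
  assume "right_accumulation_point (expansion_value p c) (J p)"
  then obtain y where y: "\<And>n. y n \<in> J p" "\<And>n. expansion_value p c < y n"
    and lim: "y \<longlonglongrightarrow> expansion_value p c"
    unfolding right_accumulation_point_def by auto
  show "infinite {i. c i = 0}"
  proof
    assume "finite {i. c i = 0}"
    then obtain N where N: "\<And>i. c i = 0 \<Longrightarrow> i < N"
      unfolding finite_nat_set_iff_bounded by auto
    \<comment> \<open>All zeros of \<open>c\<close> lie below \<open>N\<close>, so a first
      difference at a zero \<open>m\<close> has \<open>Suc m \<le> N\<close>, and \<open>g\<close>
      is at most the gap there. It is thus a uniform lower bound.\<close>
    define g where "g = (p - 2) / ((p - 1) * p ^ N)"
    have "g > 0" using p by (simp add: g_def)
    have "y n \<ge> expansion_value p c + g" for n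
    proof -
      obtain d where d: "d \<in> digit_seqs" "y n = expansion_value p d"
        using y(1)[of n] p by (auto simp: J_eq_image)
      with y(2)[of n] have "c \<noteq> d" by auto
      then obtain m where m: "\<And>k. k < m \<Longrightarrow> c k = d k" "c m \<noteq> d m"
        by (metis first_difference)
      have "\<not> d m < c m"
      proof
        assume "d m < c m"
        then have "expansion_value p c - expansion_value p d \<ge> (p - 2) / ((p - 1) * p ^ Suc m)"
          using expansion_value_gap[of p d c m] m p c d by auto
        moreover have "(p - 2) / ((p - 1) * p ^ Suc m) > 0" using p by simp
        ultimately show False using y(2)[of n] d by linarith
      qed
      with m have "c m < d m" by simp
      then have "c m = 0" using digit_le_1[OF d(1), of m] by simp
      with N have "Suc m \<le> N" by (simp add: Suc_leI)
      then have "g \<le> (p - 2) / ((p - 1) * p ^ Suc m)"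
        unfolding g_def using p
        by (intro divide_left_mono mult_left_mono power_increasing mult_pos_pos) auto
      also have "\<dots> \<le> expansion_value p d - expansion_value p c"
        using expansion_value_gap[of p c d m] m \<open>c m < d m\<close> p c d by auto
      finally show ?thesis using d by simp
    qed
    then have "expansion_value p c \<ge> expansion_value p c + g"
      by (intro LIMSEQ_le_const[OF lim]) auto
    with \<open>g > 0\<close> show False by simp
  qed
qed

lemma digit_complement: "c \<in> digit_seqs \<Longrightarrow> (\<lambda>i. 1 - c i) \<in> digit_seqs"
  unfolding digit_seqs_def by auto

lemma expansion_value_complement:
  assumes "b > 1" "c \<in> digit_seqs"
  shows "expansion_value b (\<lambda>i. 1 - c i) = 1 / (b - 1) - expansion_value b c"
proof -
  have "(\<lambda>i. 1 / b ^ Suc i - real (c i) / b ^ Suc i) sums (1 / (b - 1) - expansion_value b c)"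
    unfolding expansion_value_def
    using assms by (intro sums_diff sums_geometric_expansion summable_sums summable_expansion)
  moreover have "1 / b ^ Suc i - real (c i) / b ^ Suc i = real (1 - c i) / b ^ Suc i" for i
    using digit_le_1[OF assms(2), of i] by (simp add: of_nat_diff diff_divide_distrib)
  ultimately show ?thesis
    unfolding expansion_value_def by (simp add: sums_iff)
qed

text \<open>Complementing all digits reflects \<open>J p\<close> in the midpoint of
  \<open>{0..1 / (p - 1)}\<close>. This exchanges left and right as well as zeros and ones, so the
  left case reduces to the right one.\<close>

lemma J_reflect:
  assumes "p > 1" "x \<in> J p"
  shows "1 / (p - 1) - x \<in> J p"
  using assms digit_complement by (force simp: J_eq_image simp flip: expansion_value_complement)

lemma left_accumulation_point_iff:
  assumes p: "p > 2" and c: "c \<in> digit_seqs"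
  shows "left_accumulation_point (expansion_value p c) (J p) \<longleftrightarrow> infinite {i. c i = 1}"
proof -
  let ?x = "expansion_value p c" and ?r = "1 / (p - 1)"
  have "left_accumulation_point ?x (J p) \<longleftrightarrow> right_accumulation_point (?r - ?x) (J p)"
  proof
    assume "left_accumulation_point ?x (J p)"
    then obtain y where "\<And>n. y n \<in> J p \<and> y n < ?x" "y \<longlonglongrightarrow> ?x"
      unfolding left_accumulation_point_def by auto
    then show "right_accumulation_point (?r - ?x) (J p)"
      unfolding right_accumulation_point_def
      using p by (intro exI[of _ "\<lambda>n. ?r - y n"]) (auto intro!: J_reflect tendsto_intros)
  next
    assume "right_accumulation_point (?r - ?x) (J p)"
    then obtain y where y: "\<And>n. y n \<in> J p \<and> ?r - ?x < y n" "y \<longlonglongrightarrow> ?r - ?x"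
      unfolding right_accumulation_point_def by auto
    have "(\<lambda>n. ?r - y n) \<longlonglongrightarrow> ?r - (?r - ?x)"
      by (intro tendsto_intros y)
    moreover have "?r - y n \<in> J p \<and> ?r - y n < ?x" for n
      using J_reflect[of p "y n"] y(1)[of n] p by (simp add: algebra_simps)
    ultimately show "left_accumulation_point ?x (J p)"
      unfolding left_accumulation_point_def
      by (intro exI[of _ "\<lambda>n. ?r - y n"]) simp
  qed
  also have "\<dots> \<longleftrightarrow> infinite {i. 1 - c i = 0}"
    using right_accumulation_point_iff[OF p digit_complement[OF c]] p c
    by (subst expansion_value_complement[symmetric]) auto
  also have "{i. 1 - c i = 0} = {i. c i = 1}"
    using digit_le_1[OF c] by (auto intro: antisym)
  finally show ?thesis .
qed

lemma not_isolated_in_J: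
  assumes "p > 2"
  shows "\<not> x isolated_in J p"
proof
  assume "x isolated_in J p"
  then obtain T where T: "x \<in> J p" "open T" "T \<inter> J p = {x}"
    unfolding isolated_in_def by auto
  obtain c where c: "c \<in> digit_seqs" and x: "x = expansion_value p c"
    using T(1) assms by (auto simp: J_eq_image)
  \<comment> \<open>Flipping the digit at position \<open>n\<close> gives a different point of
    \<open>J p\<close> at distance exactly \<open>1 / p ^ Suc n\<close>.\<close>
  define y where "y n = expansion_value p (c(n := 1 - c n))" for n
  have digit: "1 - c n \<in> {0, 1}" for n by auto
  have y_J: "y n \<in> J p" for n
    using assms digit_seqs_fun_upd[OF c digit] by (auto simp: J_eq_image y_def)
  have dist: "\<bar>y n - x\<bar> = 1 / p ^ Suc n" for n
    using expansion_value_fun_upd[OF _ c digit, of p n n] assms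
    by (cases rule: digit_cases[OF c, of n]) (auto simp: y_def x)
  have "(\<lambda>n. y n - x) \<longlonglongrightarrow> 0"
    using tendsto_inverse_power_Suc[of p] assms
    by (subst tendsto_rabs_zero_iff[symmetric]) (simp add: dist del: power_Suc)
  then have "y \<longlonglongrightarrow> x" by (simp add: LIM_zero_iff)
  moreover have "x \<in> T" using T(3) by auto
  ultimately have "eventually (\<lambda>n. y n \<in> T) sequentially"
    using T(2) by (auto simp: tendsto_def)
  then obtain n where "y n \<in> T" by (auto simp: eventually_sequentially)
  with y_J T(3) have "y n = x" by auto
  with dist[of n] assms show False by simp
qed

lemma cantor_set_J:
  assumes "p > 2"
  shows "cantor_set (J p)"
proof -
  have "J p \<noteq> {}"
    using assms by (auto simp: J_eq_image digit_seqs_def)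
  \<comment> \<open>The interior is an open subset of a null set, hence empty.\<close>
  moreover have "interior (J p) = {}"
    using null_sets_J[OF assms] open_not_negligible[OF open_interior]
    by (meson interior_subset negligible_iff_null_sets negligible_subset)
  ultimately show ?thesis
    using assms by (simp add: cantor_set_def compact_J not_isolated_in_J)
qed

section \<open>Binary reading of the digits and its Hoelder estimate\<close>

lemma expansion_value_2_surj:
  assumes "0 \<le> y" "y < 1"
  shows "y \<in> expansion_value 2 ` digit_seqs"
proof
  \<comment> \<open>\<open>f n / 2 ^ n\<close> is \<open>y\<close> truncated to \<open>n\<close>
    binary digits, and \<open>c\<close> lists the digits gained at each stage. The bounds on
    \<open>y\<close> give \<open>f 0 = 0\<close>, which starts the induction.\<close>
  define f where "f n = \<lfloor>2 ^ n * y\<rfloor>" for n :: nat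
  define c where "c i = nat (f (Suc i) - 2 * f i)" for i
  have f_Suc: "2 * f i \<le> f (Suc i)" "f (Suc i) \<le> 2 * f i + 1" for i
    unfolding f_def by (simp_all add: mult.assoc) linarith+
  show c: "c \<in> digit_seqs"
    using f_Suc(2) by (simp add: digit_seqs_def c_def nat_le_iff algebra_simps)
  have "(\<Sum>i<n. real (c i) / 2 ^ Suc i) = f n / 2 ^ n" for n
  proof (induction n)
    case 0
    show ?case using assms by (simp add: f_def floor_eq_iff)
  next
    case (Suc n)
    have "real (c n) = f (Suc n) - 2 * f n"
      using f_Suc(1)[of n] by (simp add: c_def)
    with Suc show ?case by (simp add: field_simps)
  qed
  moreover have "(\<lambda>n. f n / 2 ^ n) \<longlonglongrightarrow> y"
  proof (rule tendsto_sandwich)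
    have "f n / 2 ^ n \<le> y \<and> y - 1 / 2 ^ n \<le> f n / 2 ^ n" for n
    proof -
      have "real_of_int (f n) \<le> 2 ^ n * y" "2 ^ n * y - 1 \<le> real_of_int (f n)"
        unfolding f_def by linarith+
      then have "f n / 2 ^ n \<le> y" "(2 ^ n * y - 1) / 2 ^ n \<le> f n / 2 ^ n"
        by (simp_all add: divide_le_eq mult.commute divide_right_mono)
      then show ?thesis by (simp add: diff_divide_distrib)
    qed
    then show "\<forall>\<^sub>F n in sequentially. y - 1 / 2 ^ n \<le> f n / 2 ^ n"
      "\<forall>\<^sub>F n in sequentially. f n / 2 ^ n \<le> y" by auto
    have "(\<lambda>n. y - (1 / 2) ^ n) \<longlonglongrightarrow> y - 0"
      by (intro tendsto_intros) auto
    then show "(\<lambda>n. y - 1 / 2 ^ n) \<longlonglongrightarrow> y" by (simp add: power_divide)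
  qed auto
  ultimately show "y = expansion_value 2 c"
    by (simp add: expansion_value_def sums_def sums_unique)
qed

lemma power_powr_commute:
  fixes x :: real
  assumes "x > 0"
  shows "(x ^ n) powr s = (x powr s) ^ n"
  using assms by (simp add: powr_powr powr_power mult.commute flip: powr_realpow)

text \<open>If the first difference is at \<open>n\<close>, the base \<open>p\<close> values are at
  least a constant times \<open>1 / p ^ Suc n\<close> apart, while the binary values are at most
  \<open>1 / 2 ^ n\<close> apart. Raising to the power \<open>s\<close> turns \<open>p\<close> into
  2; the factor 2 pays for \<open>Suc n\<close> against \<open>n\<close>.\<close>

lemma expansion_value_holder:
  assumes p: "p > 2" and s: "s > 0" "p powr s = 2" and cd: "c \<in> digit_seqs" "d \<in> digit_seqs"
  shows "\<bar>expansion_value 2 c - expansion_value 2 d\<bar>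
    \<le> 2 * ((p - 1) / (p - 2)) powr s * \<bar>expansion_value p c - expansion_value p d\<bar> powr s"
proof (cases "c = d")
  case False
  then obtain n where n: "\<And>k. k < n \<Longrightarrow> c k = d k" "c n \<noteq> d n"
    by (metis first_difference)
  let ?k = "(p - 1) / (p - 2)"
  have "?k > 0" using p by simp
  have "1 / p ^ Suc n \<le> ?k * \<bar>expansion_value p c - expansion_value p d\<bar>"
    using expansion_value_gap_abs[of p c d n] n cd p
    by (simp add: field_simps abs_minus_commute)
  then have "(1 / p ^ Suc n) powr s \<le> (?k * \<bar>expansion_value p c - expansion_value p d\<bar>) powr s"
    using s p by (intro powr_mono2) auto
  moreover have "(1 / p ^ Suc n) powr s = 1 / 2 ^ Suc n"
    using p s by (simp add: powr_divide power_powr_commute del: power_Suc)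
  moreover have "\<bar>expansion_value 2 c - expansion_value 2 d\<bar> \<le> 1 / 2 ^ n"
    using expansion_value_dist_le[of 2 c d n] n cd by simp
  moreover have "(?k * \<bar>expansion_value p c - expansion_value p d\<bar>) powr s
      = ?k powr s * \<bar>expansion_value p c - expansion_value p d\<bar> powr s"
    by (rule powr_mult)
  ultimately show ?thesis by simp
qed simp

subsection \<open>Hausdorff dimension\<close>

lemma diameter_pow_antimono:
  assumes "0 \<le> t" "t \<le> s" "bounded U" "diameter U \<le> 1"
  shows "diameter_pow s U \<le> diameter_pow t U"
  using assms diameter_ge_0[OF assms(3)]
  by (auto simp: diameter_pow_def powr_le1 intro!: ennreal_leI powr_mono')

text \<open>The scale 1 is chosen so that powers of the diameters decrease as the exponent
  grows.\<close>

lemma hausdorff_premeasure_antimono: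
  assumes "0 \<le> t" "t \<le> s"
  shows "hausdorff_premeasure s 1 S \<le> hausdorff_premeasure t 1 S"
  unfolding hausdorff_premeasure_def
proof (rule Inf_mono, clarify)
  fix U :: "nat \<Rightarrow> 'a set"
  assume U: "S \<subseteq> (\<Union>i. U i)" "\<forall>i. bounded (U i) \<and> diameter (U i) \<le> 1"
  then have "(\<Sum>i. diameter_pow s (U i)) \<le> (\<Sum>i. diameter_pow t (U i))"
    using assms by (intro suminf_le diameter_pow_antimono) auto
  with U show "\<exists>a\<in>{(\<Sum>i. diameter_pow s (U i)) | U :: nat \<Rightarrow> 'a set.
      S \<subseteq> (\<Union>i. U i) \<and> (\<forall>i. bounded (U i) \<and> diameter (U i) \<le> 1)}.
      a \<le> (\<Sum>i. diameter_pow t (U i))" by blast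
qed

text \<open>A cover of \<open>S\<close> is carried by \<open>g\<close> to intervals covering
  \<open>{0..<1}\<close>, whose lengths must sum to at least 1. The bound does not depend on
  \<open>\<delta>\<close>.\<close>

lemma hausdorff_premeasure_ge_holder:
  fixes g :: "'a::metric_space \<Rightarrow> real"
  assumes s: "s > 0" and K: "K > 0"
    and holder: "\<And>x y. x \<in> S \<Longrightarrow> y \<in> S \<Longrightarrow> \<bar>g x - g y\<bar> \<le> K * dist x y powr s"
    and surj: "{0..<1} \<subseteq> g ` S"
  shows "1 / ennreal (2 * K) \<le> hausdorff_premeasure s \<delta> S"
proof -
  have "1 \<le> ennreal (2 * K) * (\<Sum>i. diameter_pow s (U i))"
    if cover: "S \<subseteq> (\<Union>i. U i)" and bdd: "\<And>i. bounded (U i)" for U :: "nat \<Rightarrow> 'a set"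
  proof -
    \<comment> \<open>By the Hoelder bound, \<open>g\<close> maps \<open>U i \<inter> S\<close> into
      the interval of radius \<open>r i\<close> about the image of any one of its points. Its length
      is \<open>2 * K * diameter (U i) powr s\<close>; sets missing \<open>S\<close> get the empty
      interval.\<close>
    define r where "r i = K * diameter (U i) powr s" for i
    define I where "I i = (if U i \<inter> S = {} then {}
      else {g (SOME x. x \<in> U i \<inter> S) - r i..g (SOME x. x \<in> U i \<inter> S) + r i})" for i
    have r: "r i \<ge> 0" for i using K by (simp add: r_def)
    have g_I: "g y \<in> I i" if y: "y \<in> U i" "y \<in> S" for y i
    proof -
      define x where "x = (SOME x. x \<in> U i \<inter> S)"
      have x: "x \<in> U i \<inter> S"
        unfolding x_def by (rule someI[of _ y]) (use y in simp)
      have "\<bar>g y - g x\<bar> \<le> K * dist y x powr s"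
        using holder x y by auto
      also have "\<dots> \<le> r i"
        unfolding r_def using x y K s bdd
        by (intro mult_left_mono powr_mono2 diameter_bounded_bound) auto
      finally show ?thesis
        using x unfolding I_def x_def[symmetric] by (auto simp: abs_le_iff)
    qed
    have "g ` S \<subseteq> (\<Union>i. I i)"
    proof (rule image_subsetI)
      fix y assume "y \<in> S"
      moreover from this obtain i where "y \<in> U i" using cover by auto
      ultimately show "g y \<in> (\<Union>i. I i)" using g_I[of y i] by simp (rule exI)
    qed
    with surj have "{0..<1} \<subseteq> (\<Union>i. I i)" by (rule subset_trans)
    then have "emeasure lborel {0..<1::real} \<le> emeasure lborel (\<Union>i. I i)"
      by (rule emeasure_mono) (auto simp: I_def)
    also have "\<dots> \<le> (\<Sum>i. emeasure lborel (I i))"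
      by (rule emeasure_subadditive_countably) (auto simp: I_def)
    also have "\<dots> \<le> (\<Sum>i. ennreal (2 * K) * diameter_pow s (U i))"
    proof (rule suminf_le)
      show "emeasure lborel (I i) \<le> ennreal (2 * K) * diameter_pow s (U i)" for i
        using s K r[of i] by (auto simp: I_def diameter_pow_def r_def ennreal_mult' mult.assoc)
    qed auto
    finally show ?thesis by simp
  qed
  then show ?thesis
    unfolding hausdorff_premeasure_def using K
    by (intro Inf_greatest) (auto simp: divide_le_posI_ennreal mult.commute)
qed

section \<open>Critical exponent of \<open>J p\<close>\<close>

lemma hausdorff_measure_J_pos:
  assumes p: "p > 2" and t: "0 \<le> t" "t \<le> s" and s: "s > 0" "p powr s = 2"
  shows "hausdorff_measure t (J p) \<noteq> 0"
proof -
  \<comment> \<open>Recover the unique digits of a point in base \<open>p\<close> and read them in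
    base 2.\<close>
  define g where "g = expansion_value 2 \<circ> inv_into digit_seqs (expansion_value p)"
  define K where "K = 2 * ((p - 1) / (p - 2)) powr s"
  have g: "g (expansion_value p c) = expansion_value 2 c" if "c \<in> digit_seqs" for c
    using inv_into_f_f[OF inj_on_expansion_value[OF p] that] by (simp add: g_def)
  have "K > 0" using p by (simp add: K_def)
  have "1 / ennreal (2 * K) \<le> hausdorff_premeasure s 1 (J p)"
  proof (rule hausdorff_premeasure_ge_holder[where g = g])
    show "\<bar>g x - g y\<bar> \<le> K * dist x y powr s" if "x \<in> J p" "y \<in> J p" for x y
      using that p s g expansion_value_holder by (auto simp: J_eq_image dist_real_def K_def)
    show "{0..<1} \<subseteq> g ` J p"
    proof
      fix y :: real
      assume "y \<in> {0..<1}"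
      then obtain c where "c \<in> digit_seqs" "y = expansion_value 2 c"
        using expansion_value_2_surj[of y] by auto
      with g[of c] p show "y \<in> g ` J p" by (force simp: J_eq_image)
    qed
  qed (use s \<open>K > 0\<close> in auto)
  then have "hausdorff_premeasure s 1 (J p) \<noteq> 0"
    by auto
  \<comment> \<open>Positivity at the critical exponent \<open>s\<close> passes to every smaller
    \<open>t\<close>.\<close>
  then have "hausdorff_premeasure t 1 (J p) \<noteq> 0"
    using hausdorff_premeasure_antimono[OF t, of "J p"] by auto
  moreover have "hausdorff_premeasure t 1 (J p) \<le> hausdorff_measure t (J p)"
    unfolding hausdorff_measure_def by (rule SUP_upper) simp
  ultimately show ?thesis by auto
qed

lemma hausdorff_premeasure_J_le:
  assumes p: "p > 1" and t: "t > 0" and \<delta>: "1 / ((p - 1) * p ^ n) \<le> \<delta>"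
  shows "hausdorff_premeasure t \<delta> (J p) \<le> ennreal (2 ^ n * (1 / ((p - 1) * p ^ n)) powr t)"
proof -
  let ?r = "1 / ((p - 1) * p ^ n)"
  \<comment> \<open>\<open>A\<close> is the set of prefixes of length \<open>n\<close>, enumerated
    by \<open>h\<close>. Each prefix gives one cylinder; the indices from \<open>2 ^ n\<close> on
    get empty sets, which contribute 0 to the sum.\<close>
  define A where "A = PiE {..<n} (\<lambda>_. {0, 1::nat})"
  have "finite A" "card A = 2 ^ n"
    by (simp_all add: A_def finite_PiE card_PiE numeral_2_eq_2)
  then obtain h :: "nat \<Rightarrow> _" where h: "bij_betw h {0..<2 ^ n} A"
    using ex_bij_betw_nat_finite by metis
  define U where "U i = (if i < 2 ^ n
    then expansion_value p ` {c \<in> digit_seqs. \<forall>k<n. c k = h i k} else {})" for i :: nat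
  have r: "?r \<ge> 0" using p by simp
  have cover: "J p \<subseteq> (\<Union>i. U i)"
  proof
    fix x assume "x \<in> J p"
    then obtain c where c: "c \<in> digit_seqs" "x = expansion_value p c"
      using p by (auto simp: J_eq_image)
    then have "restrict c {..<n} \<in> A"
      using digit_le_1[of c] by (simp add: A_def restrict_PiE_iff le_Suc_eq)
    then have "restrict c {..<n} \<in> h ` {0..<2 ^ n}"
      using h by (simp add: bij_betw_def)
    then obtain i where "i < 2 ^ n" "h i = restrict c {..<n}" by auto
    with c have "x \<in> U i" by (auto simp: U_def)
    then show "x \<in> (\<Union>i. U i)" by blast
  qed
  have bdd: "bounded (U i)" for i
  proof (rule bounded_subset)
    show "bounded (J p)" using compact_J[OF p] by (rule compact_imp_bounded)
    show "U i \<subseteq> J p" using p by (auto simp: U_def J_eq_image)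
  qed
  have diam: "diameter (U i) \<le> ?r" for i
  proof (rule diameter_le)
    show "norm (x - y) \<le> ?r" if "x \<in> U i" "y \<in> U i" for x y
      using that p by (auto simp: U_def intro!: expansion_value_dist_le split: if_splits)
  qed (use r in simp)
  have "hausdorff_premeasure t \<delta> (J p) \<le> (\<Sum>i. diameter_pow t (U i))"
    unfolding hausdorff_premeasure_def
    using cover bdd order_trans[OF diam \<delta>] by (intro Inf_lower CollectI exI[of _ U]) auto
  also have "\<dots> = (\<Sum>i<2 ^ n. diameter_pow t (U i))"
    by (rule suminf_finite) (auto simp: U_def diameter_pow_def)
  also have "\<dots> \<le> (\<Sum>i<2 ^ n::nat. ennreal (?r powr t))"
    using t diam diameter_ge_0[OF bdd]
    by (intro sum_mono) (auto simp: diameter_pow_def intro!: ennreal_leI powr_mono2)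
  also have "\<dots> = ennreal (2 ^ n * ?r powr t)"
    by (simp add: ennreal_mult' flip: ennreal_power)
  finally show ?thesis .
qed

lemma hausdorff_measure_J_eq_0:
  assumes p: "p > 1" and t: "t > 0" "p powr t > 2"
  shows "hausdorff_measure t (J p) = 0"
proof -
  \<comment> \<open>The bound from the cylinders of level \<open>n\<close> is geometric in
    \<open>n\<close>, with ratio \<open>2 / p powr t < 1\<close>.\<close>
  have eq: "2 ^ n * (1 / ((p - 1) * p ^ n)) powr t
      = (1 / (p - 1)) powr t * (2 / p powr t) ^ n" for n
    using p by (simp add: powr_divide powr_mult power_divide power_powr_commute)
  have "(\<lambda>n. (1 / (p - 1)) powr t * (2 / p powr t) ^ n) \<longlonglongrightarrow> (1 / (p - 1)) powr t * 0"
    using p t by (intro tendsto_intros LIMSEQ_power_zero) (simp add: divide_less_eq)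
  then have lim: "(\<lambda>n. ennreal (2 ^ n * (1 / ((p - 1) * p ^ n)) powr t)) \<longlonglongrightarrow> ennreal 0"
    unfolding eq by (intro tendsto_ennrealI) simp
  have small: "(\<lambda>n. 1 / ((p - 1) * p ^ n)) \<longlonglongrightarrow> 0"
    using tendsto_mult[OF tendsto_const[of "1 / (p - 1)"] LIMSEQ_power_zero[of "1 / p"]] p
    by (simp add: power_divide)
  \<comment> \<open>For fixed \<open>\<delta>\<close>, all sufficiently deep levels are admissible
    covers, so the limit of their bounds applies.\<close>
  have "hausdorff_premeasure t \<delta> (J p) \<le> 0" if "\<delta> > 0" for \<delta>
  proof -
    have "\<forall>\<^sub>F n in sequentially. 1 / ((p - 1) * p ^ n) < \<delta>"
      using order_tendstoD(2)[OF small that] .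
    then have "\<forall>\<^sub>F n in sequentially. hausdorff_premeasure t \<delta> (J p)
        \<le> ennreal (2 ^ n * (1 / ((p - 1) * p ^ n)) powr t)"
      by eventually_elim (use p t in \<open>auto intro!: hausdorff_premeasure_J_le\<close>)
    then have "hausdorff_premeasure t \<delta> (J p) \<le> ennreal 0"
      by (rule tendsto_lowerbound[OF lim]) simp
    then show ?thesis by simp
  qed
  then show ?thesis
    by (auto simp: hausdorff_measure_def SUP_eq_iff intro!: antisym SUP_least)
qed

lemma hausdorff_dimension_J:
  assumes p: "p > 2"
  shows "hausdorff_dimension (J p) = ennreal (1 / log 2 p)"
proof (rule antisym)
  let ?s = "1 / log 2 p"
  have s: "?s > 0" using p by simp
  have ps: "p powr ?s = 2"
    using p by (simp add: log_def powr_def)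
  show "hausdorff_dimension (J p) \<le> ennreal ?s"
  proof (rule ennreal_le_epsilon)
    \<comment> \<open>The vanishing result requires \<open>p powr t > 2\<close>, which fails at the
      critical exponent itself; hence the approach from above by \<open>e\<close>.\<close>
    fix e :: real assume e: "e > 0"
    have "p powr ?s < p powr (?s + e)"
      using p e by (intro powr_less_mono) auto
    then have "hausdorff_measure (?s + e) (J p) = 0"
      using p add_pos_pos[OF s e] ps by (intro hausdorff_measure_J_eq_0) auto
    then have "hausdorff_dimension (J p) \<le> ennreal (?s + e)"
      unfolding hausdorff_dimension_def
      using add_pos_pos[OF s e] by (intro Inf_lower CollectI exI[of _ "?s + e"]) auto
    then show "hausdorff_dimension (J p) \<le> ennreal ?s + ennreal e"
      using s e by (simp add: ennreal_plus)
  qed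
  show "ennreal ?s \<le> hausdorff_dimension (J p)"
    unfolding hausdorff_dimension_def
  proof (rule Inf_greatest, clarify)
    fix t :: real assume "0 \<le> t" "hausdorff_measure t (J p) = 0"
    \<comment> \<open>An exponent \<open>t \<le> ?s\<close> would have nonzero measure.\<close>
    then have "?s \<le> t"
      using hausdorff_measure_J_pos[OF p _ _ s ps, of t] by force
    then show "ennreal ?s \<le> ennreal t" by (rule ennreal_leI)
  qed
qed

theorem theorem1p4:
  fixes p :: real
  assumes "p > 2"
  shows "J p \<subseteq> {0..1 / (p - 1)}
    \<and> (\<forall>x\<in>J p. \<exists>!c. is_expansion p c x)
    \<and> (cantor_set (J p)
        \<and> hausdorff_dimension (J p) = ennreal (1 / log 2 p)
        \<and> J p \<in> null_sets lebesgue)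
    \<and> (\<forall>x\<in>J p. \<forall>c. is_expansion p c x \<longrightarrow>
          (right_accumulation_point x (J p) \<longleftrightarrow> infinite {i. c i = 0}))
    \<and> (\<forall>x\<in>J p. \<forall>c. is_expansion p c x \<longrightarrow>
          (left_accumulation_point x (J p) \<longleftrightarrow> infinite {i. c i = 1}))"
proof -
  have p: "p > 1" using assms by simp
  have "\<exists>!c. is_expansion p c x" if "x \<in> J p" for x
    using that inj_onD[OF inj_on_expansion_value[OF assms]]
    unfolding J_def is_expansion_iff[OF p] by blast
  then show ?thesis
    using J_subset[OF p] cantor_set_J hausdorff_dimension_J null_sets_J
      right_accumulation_point_iff left_accumulation_point_iff assms
    by (auto simp: is_expansion_iff[OF p])
qed

end
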